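(* The normal modal logics $\mathbf{K}$ and $\mathbf{KB}$ enjoy the uniform Lyndon interpolation property (ULIP). Moreover, for $L\in\{\mathbf{K},\mathbf{KB}\}$, for any formula $\varphi$ and any finite sets $P,Q$ of propositional variables, there exists a uniform Lyndon interpolant $\theta$ of $(\varphi,P,Q)$ in $L$ with $d(\theta)\le d(\varphi)$.
   Context: Formulas are built from countably many propositional variables, the constant $\bot$ and the connectives $\to$ and $\Box$ ($\neg,\land,\top,\Diamond$ are abbreviations). The modal depth is defined by $d(p)=d(\bot)=0$, $d(\varphi\to\psi)=\max\{d(\varphi),d(\psi)\}$, $d(\Box\varphi)=d(\varphi)+1$. The sets $v^+(\varphi)$, $v^-(\varphi)$ of variables occurring positively/negatively are defined by: $v^+(p)=\{p\}$, $v^-(p)=\emptyset$; $v^\pm(\bot)=\emptyset$; $v^+(\psi\to\theta)=v^-(\psi)\cup v^+(\theta)$, $v^-(\psi\to\theta)=v^+(\psi)\cup v^-(\theta)$; $v^\pm(\Box\psi)=v^\pm(\psi)$. A normal logic is a set of formulas containing all propositional tautologies and $\Box(p\to q)\to(\Box p\to\Box q)$, closed under modus ponens, necessitation and uniform substitution; $L\vdash\varphi$ means $\varphi\in L$. $\mathbf{K}$ is the least normal logic, and for a set $X$ of formulas $\mathbf{K}+X$ is the least normal logic containing $X$; $\mathbf{KB}=\mathbf{K}+\{p\to\Box\Diamond p\}$. For a normal logic $L$, a formula $\varphi$ and finite sets $P,Q$ of variables, a uniform Lyndon interpolant of $(\varphi,P,Q)$ in $L$ is a formula $\theta$ with $v^+(\theta)\subseteq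 v^+(\varphi)\setminus P$, $v^-(\theta)\subseteq v^-(\varphi)\setminus Q$, $L\vdash\varphi\to\theta$, and such that for every formula $\psi$ with $v^+(\psi)\cap P=v^-(\psi)\cap Q=\emptyset$ and $L\vdash\varphi\to\psi$ we have $L\vdash\theta\to\psi$. $L$ enjoys ULIP if such an interpolant exists for every $\varphi$ and all finite $P,Q$. *)

theory Defs
  imports Main
begin

datatype fm =
    Var nat
  | Bot  (\<open>\<^bold>\<bottom>\<close>)
  | Imp fm fm  (infixr \<open>\<^bold>\<longrightarrow>\<close> 55)
  | Box fm  (\<open>\<^bold>\<box> _\<close> [70] 70)

abbreviation Neg :: "fm \<Rightarrow> fm"  (\<open>\<^bold>\<not> _\<close> [70] 70) where
  "\<^bold>\<not> \<phi> \<equiv> \<phi> \<^bold>\<longrightarrow> \<^bold>\<bottom>"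

abbreviation Dia :: "fm \<Rightarrow> fm"  (\<open>\<^bold>\<diamond> _\<close> [70] 70) where
  "\<^bold>\<diamond> \<phi> \<equiv> \<^bold>\<not> \<^bold>\<box> \<^bold>\<not> \<phi>"

primrec depth :: "fm \<Rightarrow> nat" where
  "depth (Var p) = 0"
| "depth \<^bold>\<bottom> = 0"
| "depth (\<phi> \<^bold>\<longrightarrow> \<psi>) = max (depth \<phi>) (depth \<psi>)"
| "depth (\<^bold>\<box> \<phi>) = depth \<phi> + 1"

fun vpos :: "fm \<Rightarrow> nat set" and vneg :: "fm \<Rightarrow> nat set" where
  "vpos (Var p) = {p}"
| "vpos \<^bold>\<bottom> = {}"
| "vpos (\<phi> \<^bold>\<longrightarrow> \<psi>) = vneg \<phi> \<union> vpos \<psi>"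
| "vpos (\<^bold>\<box> \<phi>) = vpos \<phi>"
| "vneg (Var p) = {}"
| "vneg \<^bold>\<bottom> = {}"
| "vneg (\<phi> \<^bold>\<longrightarrow> \<psi>) = vpos \<phi> \<union> vneg \<psi>"
| "vneg (\<^bold>\<box> \<phi>) = vneg \<phi>"

primrec subst :: "(nat \<Rightarrow> fm) \<Rightarrow> fm \<Rightarrow> fm" where
  "subst \<sigma> (Var p) = \<sigma> p"
| "subst \<sigma> \<^bold>\<bottom> = \<^bold>\<bottom>"
| "subst \<sigma> (\<phi> \<^bold>\<longrightarrow> \<psi>) = subst \<sigma> \<phi> \<^bold>\<longrightarrow> subst \<sigma> \<psi>"
| "subst \<sigma> (\<^bold>\<box> \<phi>) = \<^bold>\<box> (subst \<sigma> \<phi>)"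

text \<open>Boxed formulas count as propositional atoms (valued by \<open>h\<close>), so the tautologies are exactly
  the substitution instances of box-free tautologies.\<close>

primrec prop_eval :: "(nat \<Rightarrow> bool) \<Rightarrow> (fm \<Rightarrow> bool) \<Rightarrow> fm \<Rightarrow> bool" where
  "prop_eval g h (Var p) = g p"
| "prop_eval g h \<^bold>\<bottom> = False"
| "prop_eval g h (\<phi> \<^bold>\<longrightarrow> \<psi>) = (prop_eval g h \<phi> \<longrightarrow> prop_eval g h \<psi>)"
| "prop_eval g h (\<^bold>\<box> \<phi>) = h \<phi>"

definition tautology :: "fm \<Rightarrow> bool" where
  "tautology \<phi> \<longleftrightarrow> (\<forall>g h. prop_eval g h \<phi>)"

definition normal_logic :: "fm set \<Rightarrow> bool" where
  "normal_logic L \<longleftrightarrow>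
     (\<forall>\<phi>. tautology \<phi> \<longrightarrow> \<phi> \<in> L) \<and>
     \<^bold>\<box> (Var 0 \<^bold>\<longrightarrow> Var 1) \<^bold>\<longrightarrow> (\<^bold>\<box> (Var 0) \<^bold>\<longrightarrow> \<^bold>\<box> (Var 1)) \<in> L \<and>
     (\<forall>\<phi> \<psi>. \<phi> \<in> L \<longrightarrow> \<phi> \<^bold>\<longrightarrow> \<psi> \<in> L \<longrightarrow> \<psi> \<in> L) \<and>
     (\<forall>\<phi>. \<phi> \<in> L \<longrightarrow> \<^bold>\<box> \<phi> \<in> L) \<and>
     (\<forall>\<phi> \<sigma>. \<phi> \<in> L \<longrightarrow> subst \<sigma> \<phi> \<in> L)"

definition logic_K :: "fm set" where
  "logic_K = \<Inter> {L. normal_logic L}"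

definition K_plus :: "fm set \<Rightarrow> fm set" where
  "K_plus X = \<Inter> {L. normal_logic L \<and> X \<subseteq> L}"

definition logic_KB :: "fm set" where
  "logic_KB = K_plus {Var 0 \<^bold>\<longrightarrow> \<^bold>\<box> (\<^bold>\<diamond> (Var 0))}"

lemma normal_logic_Inter:
  assumes "\<And>L. L \<in> S \<Longrightarrow> normal_logic L"
  shows "normal_logic (\<Inter> S)"
  using assms unfolding normal_logic_def by blast

lemma logic_K_least:
  "normal_logic logic_K" "normal_logic L \<Longrightarrow> logic_K \<subseteq> L"
  unfolding logic_K_def by (auto intro!: normal_logic_Inter)

lemma K_plus_least:
  "normal_logic (K_plus X)" "X \<subseteq> K_plus X"
  "normal_logic L \<Longrightarrow> X \<subseteq> L \<Longrightarrow> K_plus X \<subseteq> L"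
  unfolding K_plus_def by (auto intro!: normal_logic_Inter)

definition uniform_lyndon_interpolant ::
  "fm set \<Rightarrow> fm \<Rightarrow> nat set \<Rightarrow> nat set \<Rightarrow> fm \<Rightarrow> bool" where
  "uniform_lyndon_interpolant L \<phi> P Q \<theta> \<longleftrightarrow>
     vpos \<theta> \<subseteq> vpos \<phi> - P \<and>
     vneg \<theta> \<subseteq> vneg \<phi> - Q \<and>
     \<phi> \<^bold>\<longrightarrow> \<theta> \<in> L \<and>
     (\<forall>\<psi>. vpos \<psi> \<inter> P = {} \<longrightarrow> vneg \<psi> \<inter> Q = {} \<longrightarrow> \<phi> \<^bold>\<longrightarrow> \<psi> \<in> L \<longrightarrow> \<theta> \<^bold>\<longrightarrow> \<psi> \<in> L)"

definition ULIP :: "fm set \<Rightarrow> bool" where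
  "ULIP L \<longleftrightarrow>
     (\<forall>\<phi> P Q. finite P \<longrightarrow> finite Q \<longrightarrow> (\<exists>\<theta>. uniform_lyndon_interpolant L \<phi> P Q \<theta>))"

end

theory Submission
  imports Defs
begin

text \<open>Let \<open>A\<close> and \<open>B\<close> be the variables that may occur positively and negatively in the
  interpolant, and let \<open>n\<close> be the depth of \<open>\<phi>\<close>. The interpolant is the disjunction of the
  characteristic formulas, for \<open>n\<close>-layered simulations that preserve \<open>A\<close> and reflect \<open>B\<close>,
  of the worlds of the canonical model that satisfy \<open>\<phi>\<close>. If it held at a world \<open>y\<close> that refutes
  \<open>\<psi>\<close>, some \<open>x\<close> satisfying \<open>\<phi>\<close> would be \<open>n\<close>-simulated by \<open>y\<close>. A layered product then amalgamates
  \<open>x\<close> and \<open>y\<close> into one world satisfying \<open>\<phi>\<close> and refuting \<open>\<psi>\<close>. Layers may move up as well as down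
  by one, so the product of a symmetric frame is symmetric; this covers \<open>KB\<close> along with \<open>K\<close>.\<close>

section \<open>Kripke semantics\<close>

primrec sat :: "('w \<Rightarrow> 'w \<Rightarrow> bool) \<Rightarrow> (nat \<Rightarrow> 'w \<Rightarrow> bool) \<Rightarrow> 'w \<Rightarrow> fm \<Rightarrow> bool" where
  "sat R V w (Var p) = V p w"
| "sat R V w \<^bold>\<bottom> = False"
| "sat R V w (\<phi> \<^bold>\<longrightarrow> \<psi>) = (sat R V w \<phi> \<longrightarrow> sat R V w \<psi>)"
| "sat R V w (\<^bold>\<box> \<phi>) = (\<forall>u. R w u \<longrightarrow> sat R V u \<phi>)"

lemma sat_subst: "sat R V w (subst \<sigma> \<phi>) = sat R (\<lambda>p u. sat R V u (\<sigma> p)) w \<phi>"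
  by (induction \<phi> arbitrary: w) auto

text \<open>Each world induces one of the valuations that \<open>tautology\<close> ranges over,
  boxed formulas being valued by their truth there. Hence tautologies hold at every world.\<close>

lemma sat_eq_prop_eval: "sat R V w \<phi> = prop_eval (\<lambda>p. V p w) (\<lambda>\<psi>. sat R V w (\<^bold>\<box> \<psi>)) \<phi>"
  by (induction \<phi>) auto

lemma sat_tautology: "tautology \<phi> \<Longrightarrow> sat R V w \<phi>"
  by (subst sat_eq_prop_eval) (simp add: tautology_def)

text \<open>Only the frame is constrained by \<open>C\<close>: a substitution amounts to a change of
  valuation by \<open>sat_subst\<close>, and the quantifier over \<open>V\<close> absorbs
  it.\<close>

lemma normal_logic_valid: "normal_logic {\<phi>. \<forall>R V w. C R \<longrightarrow> sat R V w \<phi>}"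
  unfolding normal_logic_def by (auto simp: sat_subst intro: sat_tautology)

lemma logic_K_sound:
  fixes R :: "'w \<Rightarrow> 'w \<Rightarrow> bool"
  assumes "\<phi> \<in> logic_K"
  shows "sat R V w \<phi>"
  using assms logic_K_least(2)[OF normal_logic_valid[of "\<lambda>_ :: 'w \<Rightarrow> 'w \<Rightarrow> bool. True"]] by blast

lemma logic_KB_sound:
  fixes R :: "'w \<Rightarrow> 'w \<Rightarrow> bool"
  assumes "\<phi> \<in> logic_KB" "symp R"
  shows "sat R V w \<phi>"
proof -
  have "logic_KB \<subseteq> {\<phi>. \<forall>(R :: 'w \<Rightarrow> 'w \<Rightarrow> bool) V w. symp R \<longrightarrow> sat R V w \<phi>}"
    unfolding logic_KB_def
    by (rule K_plus_least(3)[OF normal_logic_valid]) (auto dest: sympD)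
  then show ?thesis using assms by blast
qed

section \<open>The canonical model\<close>

text \<open>Closure under necessitation is left out so that the set of formulas true at a single
  world can qualify.\<close>

definition mp_theory :: "fm set \<Rightarrow> fm set \<Rightarrow> bool" where
  "mp_theory L T \<longleftrightarrow> L \<subseteq> T \<and> (\<forall>\<phi> \<psi>. \<phi> \<in> T \<longrightarrow> \<phi> \<^bold>\<longrightarrow> \<psi> \<in> T \<longrightarrow> \<psi> \<in> T)"

definition max_theory :: "fm set \<Rightarrow> fm set \<Rightarrow> bool" where
  "max_theory L T \<longleftrightarrow> mp_theory L T \<and> \<^bold>\<bottom> \<notin> T \<and> (\<forall>\<phi>. \<phi> \<in> T \<or> \<^bold>\<not> \<phi> \<in> T)"

lemma normal_logic_tautology: "normal_logic L \<Longrightarrow> tautology \<phi> \<Longrightarrow> \<phi> \<in> L"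
  unfolding normal_logic_def by blast

lemma normal_logic_nec: "normal_logic L \<Longrightarrow> \<phi> \<in> L \<Longrightarrow> \<^bold>\<box> \<phi> \<in> L"
  unfolding normal_logic_def by blast

lemma normal_logic_subst: "normal_logic L \<Longrightarrow> \<phi> \<in> L \<Longrightarrow> subst \<sigma> \<phi> \<in> L"
  unfolding normal_logic_def by blast

lemma normal_logic_K:
  assumes "normal_logic L"
  shows "\<^bold>\<box> (\<phi> \<^bold>\<longrightarrow> \<psi>) \<^bold>\<longrightarrow> \<^bold>\<box> \<phi> \<^bold>\<longrightarrow> \<^bold>\<box> \<psi> \<in> L"
proof -
  have "\<^bold>\<box> (Var 0 \<^bold>\<longrightarrow> Var 1) \<^bold>\<longrightarrow> (\<^bold>\<box> (Var 0) \<^bold>\<longrightarrow> \<^bold>\<box> (Var 1)) \<in> L"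
    using assms unfolding normal_logic_def by blast
  from normal_logic_subst[OF assms this, of "\<lambda>p. if p = 0 then \<phi> else \<psi>"]
  show ?thesis by simp
qed

lemma mp_theory_logic: "normal_logic L \<Longrightarrow> mp_theory L L"
  unfolding mp_theory_def normal_logic_def by blast

lemma mp_theory_mp: "mp_theory L T \<Longrightarrow> \<phi> \<^bold>\<longrightarrow> \<psi> \<in> T \<Longrightarrow> \<phi> \<in> T \<Longrightarrow> \<psi> \<in> T"
  unfolding mp_theory_def by blast

lemma mp_theory_tautology:
  "normal_logic L \<Longrightarrow> mp_theory L T \<Longrightarrow> tautology \<phi> \<Longrightarrow> \<phi> \<in> T"
  using normal_logic_tautology unfolding mp_theory_def by blast

text \<open>This set is the theory generated by \<open>T\<close> and \<open>\<psi>\<close>; it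
  stands in for derivability from premises and the deduction theorem.\<close>

lemma mp_theory_extend:
  assumes "normal_logic L" "mp_theory L T"
  shows "mp_theory L {\<chi>. \<psi> \<^bold>\<longrightarrow> \<chi> \<in> T}"
proof -
  note mp = mp_theory_mp[OF assms(2)] and taut = mp_theory_tautology[OF assms]
  have "\<psi> \<^bold>\<longrightarrow> \<chi> \<in> T" if "\<chi> \<in> L" for \<chi>
    using that assms(2) by (intro mp[OF taut[of "\<chi> \<^bold>\<longrightarrow> \<psi> \<^bold>\<longrightarrow> \<chi>"]])
      (auto simp: tautology_def mp_theory_def)
  moreover have "\<psi> \<^bold>\<longrightarrow> \<chi>' \<in> T" if "\<psi> \<^bold>\<longrightarrow> \<chi> \<in> T" "\<psi> \<^bold>\<longrightarrow> \<chi> \<^bold>\<longrightarrow> \<chi>' \<in> T" for \<chi> \<chi>'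
    by (rule mp[OF mp[OF taut[of "(\<psi> \<^bold>\<longrightarrow> \<chi> \<^bold>\<longrightarrow> \<chi>') \<^bold>\<longrightarrow> (\<psi> \<^bold>\<longrightarrow> \<chi>) \<^bold>\<longrightarrow> \<psi> \<^bold>\<longrightarrow> \<chi>'"] that(2)] that(1)])
      (simp add: tautology_def)
  ultimately show ?thesis unfolding mp_theory_def by blast
qed

lemma mp_theory_unbox:
  assumes "normal_logic L" "mp_theory L T"
  shows "mp_theory L {\<chi>. \<^bold>\<box> \<chi> \<in> T}"
  using normal_logic_nec[OF assms(1)] normal_logic_K[OF assms(1)] assms(2)
  unfolding mp_theory_def by blast

text \<open>Lindenbaum's lemma via Zorn. Maximality is taken among the theories omitting
  \<open>\<phi>\<close>; consistency and negation completeness then follow from that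
  omission.\<close>

lemma max_theory_exists:
  assumes L: "normal_logic L" and T: "mp_theory L T" and \<phi>: "\<phi> \<notin> T"
  shows "\<exists>M. max_theory L M \<and> T \<subseteq> M \<and> \<phi> \<notin> M"
proof -
  define F where "F = {S. mp_theory L S \<and> T \<subseteq> S \<and> \<phi> \<notin> S}"
  have "\<exists>M\<in>F. \<forall>X\<in>F. M \<subseteq> X \<longrightarrow> X = M"
  proof (rule subset_Zorn_nonempty)
    show "F \<noteq> {}" using T \<phi> by (auto simp: F_def)
  next
    fix C assume C: "C \<noteq> {}" "subset.chain F C"
    then have sub: "C \<subseteq> F" by (simp add: subset.chain_def)
    have "\<psi>' \<in> \<Union>C" if C': "\<psi> \<in> \<Union>C" "\<psi> \<^bold>\<longrightarrow> \<psi>' \<in> \<Union>C" for \<psi> \<psi>'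
    proof -
      obtain X Y where XY: "X \<in> C" "\<psi> \<in> X" "Y \<in> C" "\<psi> \<^bold>\<longrightarrow> \<psi>' \<in> Y" using C' by blast
      have "X \<subseteq> Y \<or> Y \<subseteq> X" using C(2) XY by (auto simp: subset.chain_def)
      then show ?thesis
        using XY sub mp_theory_mp unfolding F_def by blast
    qed
    moreover have "L \<subseteq> \<Union>C" using C(1) sub unfolding F_def mp_theory_def by blast
    ultimately have "mp_theory L (\<Union>C)" unfolding mp_theory_def by blast
    then show "\<Union>C \<in> F" using C(1) sub unfolding F_def by blast
  qed
  then obtain M where MF: "M \<in> F" and max: "\<forall>X\<in>F. M \<subseteq> X \<longrightarrow> X = M" ..
  from MF have M: "mp_theory L M" "T \<subseteq> M" "\<phi> \<notin> M" by (simp_all add: F_def)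
  have maximal: "X = M" if "mp_theory L X" "\<phi> \<notin> X" "M \<subseteq> X" for X
    using max that M(2) by (simp add: F_def)
  note mp = mp_theory_mp[OF M(1)] and taut = mp_theory_tautology[OF L M(1)]
  \<comment> \<open>Otherwise the theory generated by \<open>M\<close> and \<open>\<psi>\<close>
    would still omit \<open>\<phi>\<close> and so equal \<open>M\<close> by maximality, although it
    contains \<open>\<psi>\<close>.\<close>
  have weak: "\<psi> \<^bold>\<longrightarrow> \<phi> \<in> M" if "\<psi> \<notin> M" for \<psi>
  proof (rule ccontr)
    assume "\<psi> \<^bold>\<longrightarrow> \<phi> \<notin> M"
    moreover have "\<psi> \<^bold>\<longrightarrow> \<chi> \<in> M" if "\<chi> \<in> M" for \<chi>
      using that by (intro mp[OF taut[of "\<chi> \<^bold>\<longrightarrow> \<psi> \<^bold>\<longrightarrow> \<chi>"]]) (auto simp: tautology_def)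
    ultimately have "{\<chi>. \<psi> \<^bold>\<longrightarrow> \<chi> \<in> M} = M"
      by (intro maximal mp_theory_extend L M) auto
    moreover have "\<psi> \<^bold>\<longrightarrow> \<psi> \<in> M" by (rule taut) (simp add: tautology_def)
    ultimately show False using that by blast
  qed
  have "\<psi> \<in> M \<or> \<^bold>\<not> \<psi> \<in> M" for \<psi>
  proof (rule ccontr)
    assume "\<not> ?thesis"
    then have "\<psi> \<^bold>\<longrightarrow> \<phi> \<in> M" "\<^bold>\<not> \<psi> \<^bold>\<longrightarrow> \<phi> \<in> M" by (auto intro: weak)
    then have "\<phi> \<in> M"
      by (intro mp[OF mp[OF taut[of "(\<psi> \<^bold>\<longrightarrow> \<phi>) \<^bold>\<longrightarrow> (\<^bold>\<not> \<psi> \<^bold>\<longrightarrow> \<phi>) \<^bold>\<longrightarrow> \<phi>"]]])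
        (auto simp: tautology_def)
    then show False using M(3) by blast
  qed
  moreover have "\<^bold>\<bottom> \<notin> M"
  proof
    assume "\<^bold>\<bottom> \<in> M"
    then have "\<phi> \<in> M" by (intro mp[OF taut[of "\<^bold>\<bottom> \<^bold>\<longrightarrow> \<phi>"]]) (auto simp: tautology_def)
    then show False using M(3) by blast
  qed
  ultimately show ?thesis using M unfolding max_theory_def by blast
qed

lemma max_theory_Imp:
  assumes "normal_logic L" "max_theory L w"
  shows "\<phi> \<^bold>\<longrightarrow> \<psi> \<in> w \<longleftrightarrow> (\<phi> \<in> w \<longrightarrow> \<psi> \<in> w)"
proof -
  have T: "mp_theory L w" using assms(2) by (simp add: max_theory_def)
  note mp = mp_theory_mp[OF T] and taut = mp_theory_tautology[OF assms(1) T]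
  have "\<phi> \<^bold>\<longrightarrow> \<psi> \<in> w" if "\<psi> \<in> w"
    using that by (intro mp[OF taut[of "\<psi> \<^bold>\<longrightarrow> \<phi> \<^bold>\<longrightarrow> \<psi>"]]) (auto simp: tautology_def)
  moreover have "\<phi> \<^bold>\<longrightarrow> \<psi> \<in> w" if "\<^bold>\<not> \<phi> \<in> w"
    using that by (intro mp[OF taut[of "\<^bold>\<not> \<phi> \<^bold>\<longrightarrow> \<phi> \<^bold>\<longrightarrow> \<psi>"]]) (auto simp: tautology_def)
  ultimately show ?thesis using assms(2) mp unfolding max_theory_def by blast
qed

text \<open>Worlds range over the whole type \<open>fm set\<close>; requiring both ends to be
  maximal leaves every other set isolated.\<close>

definition canonical_rel :: "fm set \<Rightarrow> fm set \<Rightarrow> fm set \<Rightarrow> bool" where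
  "canonical_rel L w u \<longleftrightarrow> max_theory L w \<and> max_theory L u \<and> (\<forall>\<phi>. \<^bold>\<box> \<phi> \<in> w \<longrightarrow> \<phi> \<in> u)"

definition canonical_val :: "nat \<Rightarrow> fm set \<Rightarrow> bool" where
  "canonical_val p w \<longleftrightarrow> Var p \<in> w"

lemma canonical_truth:
  assumes L: "normal_logic L" and "max_theory L w"
  shows "sat (canonical_rel L) canonical_val w \<phi> \<longleftrightarrow> \<phi> \<in> w"
  using assms(2)
proof (induction \<phi> arbitrary: w)
  case (Var p)
  then show ?case by (simp add: canonical_val_def)
next
  case Bot
  then show ?case by (simp add: max_theory_def)
next
  case (Imp \<phi> \<psi>)
  then show ?case by (simp add: max_theory_Imp[OF L])
next
  case (Box \<phi>)
  show ?case
  proof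
    assume sat: "sat (canonical_rel L) canonical_val w (\<^bold>\<box> \<phi>)"
    show "\<^bold>\<box> \<phi> \<in> w"
    proof (rule ccontr)
      assume "\<^bold>\<box> \<phi> \<notin> w"
      \<comment> \<open>The formulas boxed in \<open>w\<close> form a theory omitting
        \<open>\<phi>\<close>; a maximal extension that still omits \<open>\<phi>\<close> is a
        successor of \<open>w\<close> refuting \<open>\<phi>\<close>.\<close>
      moreover have "mp_theory L {\<chi>. \<^bold>\<box> \<chi> \<in> w}"
        using Box.prems by (intro mp_theory_unbox L) (simp add: max_theory_def)
      ultimately obtain u where "max_theory L u" "{\<chi>. \<^bold>\<box> \<chi> \<in> w} \<subseteq> u" "\<phi> \<notin> u"
        using max_theory_exists[OF L, of "{\<chi>. \<^bold>\<box> \<chi> \<in> w}" \<phi>] by auto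
      then show False
        using sat Box.prems Box.IH by (auto simp: canonical_rel_def[of L w])
    qed
  next
    assume "\<^bold>\<box> \<phi> \<in> w"
    then show "sat (canonical_rel L) canonical_val w (\<^bold>\<box> \<phi>)"
      using Box.IH by (auto simp: canonical_rel_def[of L w])
  qed
qed

lemma canonical_complete:
  assumes L: "normal_logic L"
    and "\<And>w. max_theory L w \<Longrightarrow> sat (canonical_rel L) canonical_val w \<phi>"
  shows "\<phi> \<in> L"
  using max_theory_exists[OF L mp_theory_logic[OF L]] assms(2) canonical_truth[OF L] by blast

lemma symp_canonical_KB: "symp (canonical_rel logic_KB)"
proof (rule sympI)
  let ?L = logic_KB
  have L: "normal_logic ?L" unfolding logic_KB_def by (rule K_plus_least)
  fix w u assume wu: "canonical_rel ?L w u"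
  then have w: "max_theory ?L w" and u: "max_theory ?L u" by (auto simp: canonical_rel_def)
  have "\<phi> \<in> w" if \<phi>: "\<^bold>\<box> \<phi> \<in> u" for \<phi>
  proof (rule ccontr)
    assume "\<phi> \<notin> w"
    then have "\<^bold>\<not> \<phi> \<in> w" using w by (auto simp: max_theory_def)
    \<comment> \<open>The axiom is instantiated with the negation of \<open>\<phi>\<close>, which
      lies in \<open>w\<close>, so that \<open>u\<close> must see a refutation of
      \<open>\<phi>\<close>.\<close>
    have "Var 0 \<^bold>\<longrightarrow> \<^bold>\<box> (\<^bold>\<diamond> (Var 0)) \<in> ?L"
      unfolding logic_KB_def using K_plus_least(2) by blast
    from normal_logic_subst[OF L this, of "\<lambda>_. \<^bold>\<not> \<phi>"]
    have "\<^bold>\<not> \<phi> \<^bold>\<longrightarrow> \<^bold>\<box> (\<^bold>\<diamond> (\<^bold>\<not> \<phi>)) \<in> w"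
      using w by (auto simp: max_theory_def mp_theory_def)
    then have "\<^bold>\<box> (\<^bold>\<diamond> (\<^bold>\<not> \<phi>)) \<in> w"
      using \<open>\<^bold>\<not> \<phi> \<in> w\<close> max_theory_Imp[OF L w] by blast
    then have "\<^bold>\<diamond> (\<^bold>\<not> \<phi>) \<in> u" using wu by (auto simp: canonical_rel_def)
    \<comment> \<open>The double negation inside this diamond keeps it from being literally the
      negation of the boxed \<open>\<phi>\<close>; semantically the two clash, hence the truth
      lemma.\<close>
    then have "sat (canonical_rel ?L) canonical_val u (\<^bold>\<diamond> (\<^bold>\<not> \<phi>))"
      by (simp only: canonical_truth[OF L u])
    moreover have "sat (canonical_rel ?L) canonical_val u (\<^bold>\<box> \<phi>)"
      using \<phi> by (simp only: canonical_truth[OF L u])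
    ultimately show False by auto
  qed
  then show "canonical_rel ?L u w" using w u by (simp add: canonical_rel_def)
qed

section \<open>Layered directed simulations\<close>

text \<open>The atomic clauses are one-way, yet both forth and back are required: \<open>Dia\<close>
  and \<open>Box\<close> both keep polarities, and forth transfers the former, back the
  latter.\<close>

primrec layered_sim ::
  "('a \<Rightarrow> 'a \<Rightarrow> bool) \<Rightarrow> (nat \<Rightarrow> 'a \<Rightarrow> bool) \<Rightarrow> ('b \<Rightarrow> 'b \<Rightarrow> bool) \<Rightarrow> (nat \<Rightarrow> 'b \<Rightarrow> bool) \<Rightarrow>
   nat set \<Rightarrow> nat set \<Rightarrow> nat \<Rightarrow> 'a \<Rightarrow> 'b \<Rightarrow> bool" where
  "layered_sim R V R' V' A B 0 x y =
     ((\<forall>p\<in>A. V p x \<longrightarrow> V' p y) \<and> (\<forall>p\<in>B. V' p y \<longrightarrow> V p x))"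
| "layered_sim R V R' V' A B (Suc n) x y =
     ((\<forall>p\<in>A. V p x \<longrightarrow> V' p y) \<and> (\<forall>p\<in>B. V' p y \<longrightarrow> V p x) \<and>
      (\<forall>x'. R x x' \<longrightarrow> (\<exists>y'. R' y y' \<and> layered_sim R V R' V' A B n x' y')) \<and>
      (\<forall>y'. R' y y' \<longrightarrow> (\<exists>x'. R x x' \<and> layered_sim R V R' V' A B n x' y')))"

lemma layered_sim_pos: "layered_sim R V R' V' A B n x y \<Longrightarrow> p \<in> A \<Longrightarrow> V p x \<Longrightarrow> V' p y"
  by (cases n) auto

lemma layered_sim_neg: "layered_sim R V R' V' A B n x y \<Longrightarrow> p \<in> B \<Longrightarrow> V' p y \<Longrightarrow> V p x"
  by (cases n) auto

text \<open>Implication swaps polarities and sends its antecedent from \<open>y\<close> back to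
  \<open>x\<close>, so both directions go through one induction.\<close>

lemma layered_sim_preserves_aux:
  assumes "layered_sim R V R' V' A B n x y" "depth \<phi> \<le> n"
  shows "(vpos \<phi> \<subseteq> A \<longrightarrow> vneg \<phi> \<subseteq> B \<longrightarrow> sat R V x \<phi> \<longrightarrow> sat R' V' y \<phi>) \<and>
    (vpos \<phi> \<subseteq> B \<longrightarrow> vneg \<phi> \<subseteq> A \<longrightarrow> sat R' V' y \<phi> \<longrightarrow> sat R V x \<phi>)"
  using assms
proof (induction \<phi> arbitrary: n x y)
  case (Var p)
  then show ?case using layered_sim_pos layered_sim_neg by fastforce
next
  case Bot
  then show ?case by simp
next
  case (Imp \<phi> \<psi>)
  from Imp.IH[OF Imp.prems(1)] Imp.prems(2) show ?case by auto
next
  case (Box \<phi>)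
  then obtain m where m: "n = Suc m" "depth \<phi> \<le> m" by (cases n) auto
  from Box.IH[OF _ m(2)] Box.prems(1) show ?case unfolding m by simp blast
qed

lemma layered_sim_preserves:
  assumes "layered_sim R V R' V' (vpos \<phi>) (vneg \<phi>) n x y" "depth \<phi> \<le> n" "sat R V x \<phi>"
  shows "sat R' V' y \<phi>"
  using layered_sim_preserves_aux[OF assms(1,2)] assms(3) by blast

section \<open>Characteristic formulas\<close>

text \<open>The result depends only on the set, so finitely many sets of conjuncts yield finitely
  many formulas up to syntactic equality.\<close>

definition Conj :: "fm set \<Rightarrow> fm" where
  "Conj S = foldr (\<lambda>\<phi> \<psi>. \<^bold>\<not> (\<phi> \<^bold>\<longrightarrow> \<^bold>\<not> \<psi>)) (SOME l. set l = S) (\<^bold>\<not> \<^bold>\<bottom>)"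

definition Disj :: "fm set \<Rightarrow> fm" where
  "Disj S = foldr (\<lambda>\<phi> \<psi>. \<^bold>\<not> \<phi> \<^bold>\<longrightarrow> \<psi>) (SOME l. set l = S) \<^bold>\<bottom>"

lemma set_some_list: "finite S \<Longrightarrow> set (SOME l. set l = S) = S"
  by (rule someI_ex) (rule finite_list)

lemma sat_Conj: "finite S \<Longrightarrow> sat R V w (Conj S) \<longleftrightarrow> (\<forall>\<phi>\<in>S. sat R V w \<phi>)"
proof -
  have "sat R V w (foldr (\<lambda>\<phi> \<psi>. \<^bold>\<not> (\<phi> \<^bold>\<longrightarrow> \<^bold>\<not> \<psi>)) l (\<^bold>\<not> \<^bold>\<bottom>)) \<longleftrightarrow> (\<forall>\<phi>\<in>set l. sat R V w \<phi>)" for l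
    by (induction l) auto
  then show "finite S \<Longrightarrow> ?thesis" by (simp add: Conj_def set_some_list)
qed

lemma sat_Disj: "finite S \<Longrightarrow> sat R V w (Disj S) \<longleftrightarrow> (\<exists>\<phi>\<in>S. sat R V w \<phi>)"
proof -
  have "sat R V w (foldr (\<lambda>\<phi> \<psi>. \<^bold>\<not> \<phi> \<^bold>\<longrightarrow> \<psi>) l \<^bold>\<bottom>) \<longleftrightarrow> (\<exists>\<phi>\<in>set l. sat R V w \<phi>)" for l
    by (induction l) auto
  then show "finite S \<Longrightarrow> ?thesis" by (simp add: Disj_def set_some_list)
qed

definition lyndon_fms :: "nat set \<Rightarrow> nat set \<Rightarrow> nat \<Rightarrow> fm set" where
  "lyndon_fms A B n = {\<phi>. vpos \<phi> \<subseteq> A \<and> vneg \<phi> \<subseteq> B \<and> depth \<phi> \<le> n}"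

lemma Conj_lyndon_fms:
  assumes "finite S" "S \<subseteq> lyndon_fms A B n"
  shows "Conj S \<in> lyndon_fms A B n"
proof -
  have "set l \<subseteq> lyndon_fms A B n \<Longrightarrow>
      foldr (\<lambda>\<phi> \<psi>. \<^bold>\<not> (\<phi> \<^bold>\<longrightarrow> \<^bold>\<not> \<psi>)) l (\<^bold>\<not> \<^bold>\<bottom>) \<in> lyndon_fms A B n" for l
    by (induction l) (auto simp: lyndon_fms_def)
  then show ?thesis using assms by (simp add: Conj_def set_some_list)
qed

lemma Disj_lyndon_fms:
  assumes "finite S" "S \<subseteq> lyndon_fms A B n"
  shows "Disj S \<in> lyndon_fms A B n"
proof -
  have "set l \<subseteq> lyndon_fms A B n \<Longrightarrow>
      foldr (\<lambda>\<phi> \<psi>. \<^bold>\<not> \<phi> \<^bold>\<longrightarrow> \<psi>) l \<^bold>\<bottom> \<in> lyndon_fms A B n" for l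
    by (induction l) (auto simp: lyndon_fms_def)
  then show ?thesis using assms by (simp add: Disj_def set_some_list)
qed

definition literals :: "(nat \<Rightarrow> 'w \<Rightarrow> bool) \<Rightarrow> nat set \<Rightarrow> nat set \<Rightarrow> 'w \<Rightarrow> fm set" where
  "literals V A B x = Var ` {p \<in> A. V p x} \<union> (\<lambda>p. \<^bold>\<not> (Var p)) ` {p \<in> B. \<not> V p x}"

text \<open>A one-way version of Hintikka-style characteristic formulas; the modal conjuncts
  together form the cover modality over the successors.\<close>

primrec char_fm ::
  "('w \<Rightarrow> 'w \<Rightarrow> bool) \<Rightarrow> (nat \<Rightarrow> 'w \<Rightarrow> bool) \<Rightarrow> nat set \<Rightarrow> nat set \<Rightarrow> nat \<Rightarrow> 'w \<Rightarrow> fm" where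
  "char_fm R V A B 0 x = Conj (literals V A B x)"
| "char_fm R V A B (Suc n) x =
     Conj (literals V A B x \<union> Dia ` char_fm R V A B n ` {x'. R x x'} \<union>
       {\<^bold>\<box> (Disj (char_fm R V A B n ` {x'. R x x'}))})"

context
  fixes A B :: "nat set" and R :: "'w \<Rightarrow> 'w \<Rightarrow> bool" and V :: "nat \<Rightarrow> 'w \<Rightarrow> bool"
  assumes fin: "finite A" "finite B"
begin

lemma finite_literals: "finite (literals V A B x)"
  using fin by (simp add: literals_def)

lemma sat_literals:
  "(\<forall>\<phi>\<in>literals V A B x. sat R' V' y \<phi>) \<longleftrightarrow>
     (\<forall>p\<in>A. V p x \<longrightarrow> V' p y) \<and> (\<forall>p\<in>B. V' p y \<longrightarrow> V p x)"
  by (auto simp: literals_def ball_Un)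

lemma literals_lyndon_fms: "literals V A B x \<subseteq> lyndon_fms A B n"
  by (auto simp: literals_def lyndon_fms_def)

text \<open>A world may have infinitely many successors. Level by level, however, every value is
  \<open>Conj\<close> of a subset of one fixed finite set, so \<open>Conj\<close> and
  \<open>Disj\<close> in \<open>char_fm\<close> are applied to finite sets.\<close>

lemma finite_range_char_fm: "finite (range (char_fm R V A B n))"
proof (induction n)
  case 0
  have "literals V A B x \<in> Pow (Var ` A \<union> (\<lambda>p. \<^bold>\<not> (Var p)) ` B)" for x
    by (auto simp: literals_def)
  then have "range (char_fm R V A B 0) \<subseteq> Conj ` Pow (Var ` A \<union> (\<lambda>p. \<^bold>\<not> (Var p)) ` B)"
    by auto
  then show ?case by (rule finite_subset) (simp add: fin)
next
  case (Suc n)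
  let ?S = "range (char_fm R V A B n)"
  let ?T = "Var ` A \<union> (\<lambda>p. \<^bold>\<not> (Var p)) ` B \<union> Dia ` ?S \<union> Box ` Disj ` Pow ?S"
  have "\<^bold>\<box> (Disj (char_fm R V A B n ` {x'. R x x'})) \<in> Box ` Disj ` Pow ?S" for x
    by (intro imageI) blast
  then have "literals V A B x \<union> Dia ` char_fm R V A B n ` {x'. R x x'} \<union>
       {\<^bold>\<box> (Disj (char_fm R V A B n ` {x'. R x x'}))} \<in> Pow ?T" for x
    by (auto simp: literals_def)
  then have "range (char_fm R V A B (Suc n)) \<subseteq> Conj ` Pow ?T"
    by auto
  then show ?case by (rule finite_subset) (simp add: fin Suc.IH)
qed

lemma finite_char_fm_image: "finite (char_fm R V A B n ` X)"
  by (rule finite_subset[OF _ finite_range_char_fm]) auto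

lemma char_fm_lyndon_fms: "char_fm R V A B n x \<in> lyndon_fms A B n"
proof (induction n arbitrary: x)
  case 0
  show ?case
    unfolding char_fm.simps by (intro Conj_lyndon_fms finite_literals literals_lyndon_fms)
next
  case (Suc n)
  let ?S = "char_fm R V A B n ` {x'. R x x'}"
  have S: "?S \<subseteq> lyndon_fms A B n" using Suc.IH by blast
  have "Disj ?S \<in> lyndon_fms A B n" by (intro Disj_lyndon_fms finite_char_fm_image S)
  then have "\<^bold>\<box> (Disj ?S) \<in> lyndon_fms A B (Suc n)" by (simp add: lyndon_fms_def)
  moreover have "Dia ` ?S \<subseteq> lyndon_fms A B (Suc n)"
    using S by (fastforce simp: lyndon_fms_def)
  ultimately show ?case
    unfolding char_fm.simps
    by (intro Conj_lyndon_fms)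
      (use literals_lyndon_fms in \<open>auto simp: finite_literals finite_char_fm_image\<close>)
qed

text \<open>The literals express the atomic clauses, the diamonds the forth clause and the boxed
  disjunction the back clause.\<close>

lemma sat_char_fm: "sat R' V' y (char_fm R V A B n x) \<longleftrightarrow> layered_sim R V R' V' A B n x y"
proof (induction n arbitrary: x y)
  case 0
  show ?case by (simp add: sat_Conj finite_literals sat_literals)
next
  case (Suc n)
  show ?case
    by (auto simp: sat_Conj sat_Disj finite_literals finite_char_fm_image ball_Un sat_literals
        Suc.IH)
qed

end

lemma layered_sim_refl: "layered_sim R V R V A B n x x"
  by (induction n arbitrary: x) auto

section \<open>Amalgamation\<close>

text \<open>A triple in layer \<open>Suc i\<close> carries an \<open>i\<close>-simulation between
  its components. The first component transfers \<open>\<phi>\<close> into the product up to depth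
  \<open>n\<close>. The second simulates the product to every depth, because layer 0 lets it walk on
  alone; hence \<open>\<psi>\<close> may be arbitrarily deep.\<close>

lemma amalgamate:
  fixes R :: "'w \<Rightarrow> 'w \<Rightarrow> bool"
  assumes sim: "layered_sim R V R V A B n x y"
    and pos: "vpos \<phi> \<inter> vpos \<psi> \<subseteq> A" and neg: "vneg \<phi> \<inter> vneg \<psi> \<subseteq> B"
    and depth: "depth \<phi> \<le> n"
    and \<phi>: "sat R V x \<phi>" and \<psi>: "\<not> sat R V y \<psi>"
  shows "\<exists>(R' :: 'w \<times> 'w \<times> nat \<Rightarrow> 'w \<times> 'w \<times> nat \<Rightarrow> bool) V' k.
    (symp R \<longrightarrow> symp R') \<and> sat R' V' k \<phi> \<and> \<not> sat R' V' k \<psi>"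
proof -
  \<comment> \<open>In layer 0 the first component is junk: these worlds are mere copies of the second one.\<close>
  define W where "W = (\<lambda>(x, y, j). \<forall>i. j = Suc i \<longrightarrow> layered_sim R V R V A B i x y)"
  \<comment> \<open>Second components always follow \<open>R\<close>, first components only between
    positive layers. All conditions besides \<open>R\<close> itself are symmetric in the two
    worlds.\<close>
  define R' where "R' = (\<lambda>k k'. W k \<and> W k' \<and> (case (k, k') of ((x, y, j), (x', y', j')) \<Rightarrow>
    R y y' \<and> (0 < j \<longrightarrow> 0 < j' \<longrightarrow> R x x') \<and> j \<le> Suc j' \<and> j' \<le> Suc j))"
  \<comment> \<open>The least valuation permitting both simulations; \<open>pos\<close> and \<open>neg\<close> keep it below their upper
    bounds.\<close>
  define V' where "V' = (\<lambda>p (x, y, j :: nat). if j = 0 then V p y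
    else p \<in> vpos \<phi> \<and> V p x \<or> p \<in> vneg \<psi> \<and> V p y)"
  \<comment> \<open>A step lowers the layer by at most one, so from a layer above \<open>i\<close>
    the first component stays genuine for \<open>i\<close> steps.\<close>
  have simL: "layered_sim R V R' V' (vpos \<phi>) (vneg \<phi>) i x (x, y, j)"
    if "W (x, y, j)" "i < j" for i j x y
    using that
  proof (induction i arbitrary: x y j)
    case 0
    then obtain j0 where j: "j = Suc j0" and s: "layered_sim R V R V A B j0 x y"
      by (cases j) (auto simp: W_def)
    \<comment> \<open>A variable of \<open>vneg \<phi>\<close> made true through \<open>y\<close>
      also lies in \<open>vneg \<psi>\<close>, hence in \<open>B\<close>, and the simulation
      reflects it to \<open>x\<close>.\<close>
    from layered_sim_neg[OF s] neg show ?case by (auto simp: V'_def j)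
  next
    case (Suc i)
    then obtain j1 where j: "j = Suc (Suc j1)" and s: "layered_sim R V R V A B (Suc j1) x y"
      by (cases j; cases "j - 1") (auto simp: W_def)
    have "\<exists>k'. R' (x, y, j) k' \<and> layered_sim R V R' V' (vpos \<phi>) (vneg \<phi>) i x' k'" if "R x x'" for x'
    proof -
      from s that obtain y' where y': "R y y'" "layered_sim R V R V A B j1 x' y'" by auto
      \<comment> \<open>The forth clause costs one level of simulation, so the successor is placed
        one layer lower.\<close>
      then have W': "W (x', y', Suc j1)" by (simp add: W_def)
      then have "R' (x, y, j) (x', y', Suc j1)"
        using Suc.prems(1) y' that by (simp add: R'_def j)
      moreover have "layered_sim R V R' V' (vpos \<phi>) (vneg \<phi>) i x' (x', y', Suc j1)"
        using Suc.IH[OF W'] Suc.prems(2) j by simp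
      ultimately show ?thesis by blast
    qed
    moreover have "\<exists>x'. R x x' \<and> layered_sim R V R' V' (vpos \<phi>) (vneg \<phi>) i x' k'"
      if "R' (x, y, j) k'" for k'
    proof -
      obtain x' y' j' where k': "k' = (x', y', j')" by (cases k')
      from that have "W (x', y', j')" "i < j'" "R x x'"
        using Suc.prems(2) by (auto simp: R'_def k' j)
      then show ?thesis using Suc.IH by (auto simp: k')
    qed
    moreover from layered_sim_neg[OF s] neg
    have "(\<forall>p\<in>vpos \<phi>. V p x \<longrightarrow> V' p (x, y, j)) \<and> (\<forall>p\<in>vneg \<phi>. V' p (x, y, j) \<longrightarrow> V p x)"
      by (auto simp: V'_def j)
    ultimately show ?case by simp
  qed
  have simR: "layered_sim R' V' R V (vpos \<psi>) (vneg \<psi>) m (x, y, j) y"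
    if "W (x, y, j)" for m j x y
    using that
  proof (induction m arbitrary: x y j)
    case 0
    \<comment> \<open>In a positive layer, a variable of \<open>vpos \<psi>\<close> made true
      through \<open>x\<close> also lies in \<open>vpos \<phi>\<close>, hence in \<open>A\<close>,
      and is preserved at \<open>y\<close>.\<close>
    with pos show ?case by (cases j) (auto simp: V'_def W_def dest: layered_sim_pos)
  next
    case (Suc m)
    have "\<exists>y'. R y y' \<and> layered_sim R' V' R V (vpos \<psi>) (vneg \<psi>) m k' y'"
      if "R' (x, y, j) k'" for k'
      using that Suc.IH by (cases k') (auto simp: R'_def)
    moreover have "\<exists>k'. R' (x, y, j) k' \<and> layered_sim R' V' R V (vpos \<psi>) (vneg \<psi>) m k' y'"
      if "R y y'" for y'
    proof -
      have "\<exists>x' j'. R' (x, y, j) (x', y', j')"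
      proof (cases "j \<le> 1")
        case True
        \<comment> \<open>From layers 0 and 1 no successor of \<open>x\<close> matching
          \<open>y'\<close> is guaranteed, so the walk moves to layer 0 with \<open>x\<close> as a
          placeholder.\<close>
        then have "R' (x, y, j) (x, y', 0)"
          using Suc.prems that by (simp add: R'_def) (simp add: W_def)
        then show ?thesis by blast
      next
        case False
        then obtain i where j: "j = Suc (Suc i)" by (cases j; cases "j - 1") auto
        with Suc.prems have "layered_sim R V R V A B (Suc i) x y" by (simp add: W_def)
        with that obtain x' where "R x x'" "layered_sim R V R V A B i x' y'" by auto
        then have "R' (x, y, j) (x', y', Suc i)"
          using Suc.prems that j by (simp add: R'_def) (simp add: W_def)
        then show ?thesis by blast
      qed
      then obtain x' j' where k': "R' (x, y, j) (x', y', j')" by blast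
      then have "W (x', y', j')" by (simp add: R'_def)
      with Suc.IH k' show ?thesis by blast
    qed
    moreover have "(\<forall>p\<in>vpos \<psi>. V' p (x, y, j) \<longrightarrow> V p y) \<and> (\<forall>p\<in>vneg \<psi>. V p y \<longrightarrow> V' p (x, y, j))"
      using Suc.prems pos by (cases j) (auto simp: V'_def W_def dest: layered_sim_pos)
    ultimately show ?case by simp
  qed
  \<comment> \<open>Layer \<open>Suc n\<close> encodes the given \<open>n\<close>-simulation and
    lies above \<open>n\<close>, as \<open>simL\<close> requires at depth \<open>n\<close>.\<close>
  have W: "W (x, y, Suc n)" using sim by (simp add: W_def)
  have "symp R'" if "symp R"
    using sympD[OF that] by (intro sympI) (auto simp: R'_def)
  moreover have "sat R' V' (x, y, Suc n) \<phi>"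
    using layered_sim_preserves[OF simL[OF W] depth \<phi>] by simp
  moreover have "\<not> sat R' V' (x, y, Suc n) \<psi>"
    using layered_sim_preserves[OF simR[OF W, of "depth \<psi>"] order.refl] \<psi> by blast
  ultimately show ?thesis by blast
qed

section \<open>Uniform Lyndon interpolants\<close>

lemma finite_vpos_vneg: "finite (vpos \<phi>)" "finite (vneg \<phi>)"
  by (induction \<phi>) auto

text \<open>The hypothesis \<open>sound\<close> is tailored to the product of the canonical model
  with itself: its worlds are triples, and its frame is symmetric if the canonical one is. This
  treats both logics at once.\<close>

lemma uniform_lyndon_interpolant_exists:
  assumes L: "normal_logic L"
    and sound: "\<And>(R :: fm set \<times> fm set \<times> nat \<Rightarrow> _) V k \<chi>.
      symp (canonical_rel L) \<longrightarrow> symp R \<Longrightarrow> \<chi> \<in> L \<Longrightarrow> sat R V k \<chi>"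
  shows "\<exists>\<theta>. uniform_lyndon_interpolant L \<phi> P Q \<theta> \<and> depth \<theta> \<le> depth \<phi>"
proof -
  let ?R = "canonical_rel L" and ?V = canonical_val
  define A B where "A = vpos \<phi> - P" and "B = vneg \<phi> - Q"
  have fin: "finite A" "finite B" by (simp_all add: A_def B_def finite_vpos_vneg)
  define S where "S = char_fm ?R ?V A B (depth \<phi>) ` {x. max_theory L x \<and> sat ?R ?V x \<phi>}"
  have finS: "finite S" unfolding S_def by (rule finite_char_fm_image[OF fin])
  have "S \<subseteq> lyndon_fms A B (depth \<phi>)" by (auto simp: S_def char_fm_lyndon_fms[OF fin])
  with finS have S: "Disj S \<in> lyndon_fms A B (depth \<phi>)" by (rule Disj_lyndon_fms)
  have sat_S: "sat ?R ?V w (Disj S) \<longleftrightarrow>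
      (\<exists>x. max_theory L x \<and> sat ?R ?V x \<phi> \<and> layered_sim ?R ?V ?R ?V A B (depth \<phi>) x w)" for w
    unfolding sat_Disj[OF finS] by (auto simp: S_def sat_char_fm[OF fin])
  \<comment> \<open>A maximal theory satisfying \<open>\<phi>\<close> simulates itself, so its own
    characteristic formula witnesses the disjunction.\<close>
  have "\<phi> \<^bold>\<longrightarrow> Disj S \<in> L"
    by (rule canonical_complete[OF L]) (auto simp: sat_S intro: layered_sim_refl)
  moreover have "Disj S \<^bold>\<longrightarrow> \<psi> \<in> L"
    if v: "vpos \<psi> \<inter> P = {}" "vneg \<psi> \<inter> Q = {}" and imp: "\<phi> \<^bold>\<longrightarrow> \<psi> \<in> L" for \<psi>
  proof (rule canonical_complete[OF L], rule ccontr)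
    fix w assume "\<not> sat ?R ?V w (Disj S \<^bold>\<longrightarrow> \<psi>)"
    then obtain x where x: "sat ?R ?V x \<phi>" "layered_sim ?R ?V ?R ?V A B (depth \<phi>) x w"
      and w: "\<not> sat ?R ?V w \<psi>"
      by (auto simp: sat_S)
    have "vpos \<phi> \<inter> vpos \<psi> \<subseteq> A" "vneg \<phi> \<inter> vneg \<psi> \<subseteq> B" using v by (auto simp: A_def B_def)
    from amalgamate[OF x(2) this order.refl x(1) w]
    obtain R' :: "fm set \<times> fm set \<times> nat \<Rightarrow> fm set \<times> fm set \<times> nat \<Rightarrow> bool" and V' k
      where "symp ?R \<longrightarrow> symp R'" "sat R' V' k \<phi>" "\<not> sat R' V' k \<psi>"
      by blast
    with sound[OF _ imp] show False by fastforce
  qed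
  ultimately show ?thesis
    using S unfolding uniform_lyndon_interpolant_def lyndon_fms_def A_def B_def by blast
qed

theorem theorem4p6:
  shows "ULIP logic_K \<and> ULIP logic_KB \<and>
    (\<forall>L \<in> {logic_K, logic_KB}. \<forall>\<phi> P Q. finite P \<longrightarrow> finite Q \<longrightarrow>
       (\<exists>\<theta>. uniform_lyndon_interpolant L \<phi> P Q \<theta> \<and> depth \<theta> \<le> depth \<phi>))"
proof -
  have "\<exists>\<theta>. uniform_lyndon_interpolant logic_K \<phi> P Q \<theta> \<and> depth \<theta> \<le> depth \<phi>" for \<phi> P Q
    by (rule uniform_lyndon_interpolant_exists) (auto intro: logic_K_least logic_K_sound)
  \<comment> \<open>Since the canonical frame is symmetric here, soundness is only demanded on
    symmetric frames.\<close>
  moreover have "\<exists>\<theta>. uniform_lyndon_interpolant logic_KB \<phi> P Q \<theta> \<and> depth \<theta> \<le> depth \<phi>" for \<phi> P Q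
  proof (rule uniform_lyndon_interpolant_exists)
    show "normal_logic logic_KB" unfolding logic_KB_def by (rule K_plus_least)
  qed (simp add: symp_canonical_KB logic_KB_sound)
  ultimately show ?thesis unfolding ULIP_def by blast
qed

end
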